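(* Let the contract parameters $(K,T,r)$ range over a compact class with $K>0$ and $T>0$ bounded away from zero. Write $\bar a(x,\tau)=a(Ke^x,T-\tau)$, where $a$ is the local variance, and assume that $\bar a$ has an extension to the full line $x\in\mathbb R$ (still denoted $\bar a$, and used as the coefficient of the problems below) such that: (i) $0<a_-\le\bar a\le a_+<\infty$; (ii) $\bar a$ is uniformly Lipschitz continuous in the spatial variable $x$; (iii) the pricing problem and the correction problem (both described in the context) have unique solutions, with comparison, in a class of functions of at most exponential growth. Let $V$ be the call price, $C^{\mathrm{ref}}$ the strike-matched carrier, and $W=V-C^{\mathrm{ref}}$. Then there is a constant $C$, independent of $\tau\in(0,T]$, such that $$\sup_{x\in\mathbb R}\frac{|W(Ke^x,T-\tau)|}{K}\le C\tau ,$$ uniformly over the compact class of contracts.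
   Context: Setting: European call on a non-dividend-paying asset with strike $K>0$, maturity $T>0$, constant interest rate $r$, and local variance $a(S,t)=\sigma^2(S,t)$, where $\sigma$ is the local volatility; $\tau=T-t$ is the remaining time and $x=\log(S/K)$ the log-moneyness. Pricing problem: $V(S,t)$ solves $\partial_tV+\tfrac12a(S,t)S^2\partial_{SS}V+rS\partial_SV-rV=0$ for $S>0$, $t<T$, with terminal payoff $V(S,T)=(S-K)^+$. Carrier: let $A_0(\tau)=\int_0^\tau a(K,T-u)\,du$ be the strike-line integrated variance and $\Phi$ the standard normal distribution function. For $S>0$ and $A_0(\tau)>0$, $$C^{\mathrm{ref}}(S,t)=S\Phi(d_+)-Ke^{-r\tau}\Phi(d_-),\qquad d_\pm=\frac{\log(S/K)+r\tau\pm A_0(\tau)/2}{\sqrt{A_0(\tau)}},$$ with limiting assignments $C^{\mathrm{ref}}(S,T)=(S-K)^+$ and $C^{\mathrm{ref}}(0,t)=0$. It is the exact call price for the spatially frozen variance $a(K,t)$. Correction problem: in the variables $(S,\tau)$, wherever classical derivatives exist, $W$ satisfies $$\partial_\tau W-\tfrac12a(S,T-\tau)S^2\partial_{SS}W-rS\partial_SW+rW=\tfrac12\,[a(S,T-\tau)-a(K,T-\tau)]\,S^2\,\partial_{SS}C^{\mathrm{ref}},$$ with zero data at $\tau=0$, i.e. $W(S,T)=0$. Equivalently, $w(x,\tau)=W(Ke^x,T-\tau)/K$ satisfies $$\partial_\tau w=\tfrac12\bar a\,w_{xx}+(r-\tfrac12\bar a)w_x-rw+\tfrac12[\bar a(x,\tau)-\bar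 a(0,\tau)]\,(\partial_{xx}-\partial_x)c^{\mathrm{ref}},\qquad w(\cdot,0)=0,$$ where $c^{\mathrm{ref}}(x,\tau)=C^{\mathrm{ref}}(Ke^x,T-\tau)/K$. In (iii) no particular notion of solution is fixed: uniqueness and the comparison principle (ordering of initial data and sources implies ordering of solutions) are assumed for whatever notion of solution is used, within an at-most-exponential-growth class. *)

theory Defs
  imports "HOL-Probability.Probability"
begin

text \<open>
  Functions of the asset price and of calendar time are written \<open>u S t\<close>; they matter only for
  \<open>S > 0\<close> and \<open>0 \<le> t \<le> T\<close>. Further, \<open>\<tau> = T - t\<close> and \<open>x = ln (S / K)\<close>.
\<close>

definition log_var :: "(real \<Rightarrow> real \<Rightarrow> real) \<Rightarrow> real \<Rightarrow> real \<Rightarrow> real \<Rightarrow> real \<Rightarrow> real" where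
  "log_var a K T x \<tau> = a (K * exp x) (T - \<tau>)"

definition strike_var :: "(real \<Rightarrow> real \<Rightarrow> real) \<Rightarrow> real \<Rightarrow> real \<Rightarrow> real \<Rightarrow> real" where
  "strike_var a K T \<tau> = integral {0..\<tau>} (\<lambda>u. a K (T - u))"

abbreviation std_normal_cdf :: "real \<Rightarrow> real" where
  "std_normal_cdf \<equiv> cdf std_normal_distribution"

definition C_ref ::
    "(real \<Rightarrow> real \<Rightarrow> real) \<Rightarrow> real \<Rightarrow> real \<Rightarrow> real \<Rightarrow> real \<Rightarrow> real \<Rightarrow> real" where
  "C_ref a K T r S t =
    (let \<tau> = T - t;
         A = strike_var a K T \<tau>;
         dp = (ln (S / K) + r * \<tau> + A / 2) / sqrt A;
         dm = (ln (S / K) + r * \<tau> - A / 2) / sqrt A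
     in if t = T then max (S - K) 0
        else if S = 0 then 0
        else S * std_normal_cdf dp - K * exp (- r * \<tau>) * std_normal_cdf dm)"

text \<open>At most exponential growth is meant in the log-moneyness, uniformly in time.\<close>

definition exp_growth :: "real \<Rightarrow> real \<Rightarrow> (real \<Rightarrow> real \<Rightarrow> real) \<Rightarrow> bool" where
  "exp_growth K T u \<longleftrightarrow>
    (\<exists>M m. \<forall>x. \<forall>\<tau>\<in>{0..T}. \<bar>u (K * exp x) (T - \<tau>)\<bar> \<le> M * exp (m * \<bar>x\<bar>))"

text \<open>
  Every problem below is a Cauchy problem
  \<open>u\<^sub>t + 1/2 a S\<^sup>2 u\<^sub>S\<^sub>S + r S u\<^sub>S - r u + F = 0\<close>, \<open>u(S,T) = g(S)\<close>,
  on \<open>S > 0\<close>, \<open>0 \<le> t < T\<close>. In terms of \<open>\<tau>\<close> the source \<open>F\<close> stands on the right-hand side of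
  \<open>u\<^sub>\<tau> - 1/2 a S\<^sup>2 u\<^sub>S\<^sub>S - r S u\<^sub>S + r u = F\<close>.

  The coefficient need not be continuous in time, so even the carrier may have a time derivative
  only at almost every time. Hence the set \<open>Z\<close> of exceptional times: the equation is imposed at
  all times outside \<open>Z\<close>, and local Lipschitz continuity in time prevents \<open>u\<close> from
  moving on the null set \<open>Z\<close>. For \<open>Z = {}\<close> the equation holds at every point.
  At \<open>t = 0\<close> the time derivative is one-sided.
\<close>

definition classical_solution ::
    "real set \<Rightarrow> (real \<Rightarrow> real \<Rightarrow> real) \<Rightarrow> real \<Rightarrow> real \<Rightarrow>
     (real \<Rightarrow> real \<Rightarrow> real) \<Rightarrow> (real \<Rightarrow> real) \<Rightarrow> (real \<Rightarrow> real \<Rightarrow> real) \<Rightarrow> bool" where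
  "classical_solution Z a r T F g u \<longleftrightarrow>
    continuous_on ({0<..} \<times> {0..T}) (\<lambda>(S, t). u S t) \<and>
    (\<forall>S>0. u S T = g S) \<and>
    (\<forall>p>0. \<forall>q. \<forall>s<T. \<exists>L. \<forall>S\<in>{p..q}. L-lipschitz_on {0..s} (u S)) \<and>
    (\<exists>uS uSS.
      continuous_on ({0<..} \<times> {0..<T}) (\<lambda>(S, t). uS S t) \<and>
      continuous_on ({0<..} \<times> {0..<T}) (\<lambda>(S, t). uSS S t) \<and>
      (\<forall>S>0. \<forall>t\<in>{0..<T}.
        ((\<lambda>s. u s t) has_real_derivative uS S t) (at S) \<and>
        ((\<lambda>s. uS s t) has_real_derivative uSS S t) (at S) \<and>
        (t \<notin> Z \<longrightarrow>
          (\<exists>ut. (u S has_real_derivative ut) (at t within {0..T}) \<and>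
            ut + 1 / 2 * a S t * S\<^sup>2 * uSS S t + r * S * uS S t - r * u S t + F S t = 0))))"

text \<open>
  If \<open>a K\<close> is integrable, Lebesgue's differentiation theorem supplies such a \<open>Z\<close>; if
  \<open>a K\<close> is continuous, \<open>Z = {}\<close> is possible.
\<close>

definition exceptional_times :: "(real \<Rightarrow> real \<Rightarrow> real) \<Rightarrow> real \<Rightarrow> real \<Rightarrow> real set \<Rightarrow> bool" where
  "exceptional_times a K T Z \<longleftrightarrow>
    negligible Z \<and>
    (\<forall>\<tau>\<in>{0<..T}. T - \<tau> \<notin> Z \<longrightarrow>
      (strike_var a K T has_real_derivative a K (T - \<tau>)) (at \<tau> within {0..T}))"

text \<open>
  A notion of solution is a relation: \<open>sol a r T F g u\<close> says that \<open>u\<close> solves the Cauchy problem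
  with coefficient \<open>a\<close>, rate \<open>r\<close>, maturity \<open>T\<close>, source \<open>F\<close> and data \<open>g\<close> in the chosen
  sense (classical, strong, weak, viscosity, ...). Since none is singled out, all that is asked is
  consistency with the classical calculus: classical solutions are solutions, and subtracting
  a classical solution from a solution subtracts the sources and the data.
\<close>

type_synonym solution_concept =
  "(real \<Rightarrow> real \<Rightarrow> real) \<Rightarrow> real \<Rightarrow> real \<Rightarrow>
   (real \<Rightarrow> real \<Rightarrow> real) \<Rightarrow> (real \<Rightarrow> real) \<Rightarrow> (real \<Rightarrow> real \<Rightarrow> real) \<Rightarrow> bool"

definition consistent ::
    "solution_concept \<Rightarrow> real set \<Rightarrow> (real \<Rightarrow> real \<Rightarrow> real) \<Rightarrow> real \<Rightarrow> real \<Rightarrow> real \<Rightarrow> bool" where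
  "consistent sol Z a K T r \<longleftrightarrow>
    (\<forall>F g v. classical_solution Z a r T F g v \<and> exp_growth K T v \<longrightarrow> sol a r T F g v) \<and>
    (\<forall>F g u F' g' v.
      sol a r T F g u \<and> exp_growth K T u \<and>
      classical_solution Z a r T F' g' v \<and> exp_growth K T v \<longrightarrow>
      sol a r T (\<lambda>S t. F S t - F' S t) (\<lambda>S. g S - g' S) (\<lambda>S t. u S t - v S t))"

definition unique_solvability ::
    "solution_concept \<Rightarrow> (real \<Rightarrow> real \<Rightarrow> real) \<Rightarrow> real \<Rightarrow> real \<Rightarrow> real \<Rightarrow>
     (real \<Rightarrow> real \<Rightarrow> real) \<Rightarrow> (real \<Rightarrow> real) \<Rightarrow> bool" where
  "unique_solvability sol a K T r F g \<longleftrightarrow>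
    (\<exists>u. exp_growth K T u \<and> sol a r T F g u) \<and>
    (\<forall>u v. exp_growth K T u \<and> sol a r T F g u \<and> exp_growth K T v \<and> sol a r T F g v \<longrightarrow>
      (\<forall>S>0. \<forall>t\<in>{0..T}. u S t = v S t))"

definition comparison_principle ::
    "solution_concept \<Rightarrow> (real \<Rightarrow> real \<Rightarrow> real) \<Rightarrow> real \<Rightarrow> real \<Rightarrow> real \<Rightarrow> bool" where
  "comparison_principle sol a K T r \<longleftrightarrow>
    (\<forall>F g u F' g' v.
      exp_growth K T u \<and> sol a r T F g u \<and> exp_growth K T v \<and> sol a r T F' g' v \<and>
      (\<forall>S>0. g S \<le> g' S) \<and> (\<forall>S>0. \<forall>t\<in>{0..<T}. F S t \<le> F' S t) \<longrightarrow>
      (\<forall>S>0. \<forall>t\<in>{0..T}. u S t \<le> v S t))"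

definition call_payoff :: "real \<Rightarrow> real \<Rightarrow> real" where
  "call_payoff K S = max (S - K) 0"

definition correction_source ::
    "(real \<Rightarrow> real \<Rightarrow> real) \<Rightarrow> real \<Rightarrow> real \<Rightarrow> real \<Rightarrow> real \<Rightarrow> real \<Rightarrow> real" where
  "correction_source a K T r S t =
    1 / 2 * (a S t - a K t) * S\<^sup>2 * (deriv ^^ 2) (\<lambda>s. C_ref a K T r s t) S"

end

theory Submission
  imports Defs "HOL-Real_Asymp.Real_Asymp"
begin

text \<open>
  The carrier solves the pricing problem up to the source \<open>[a(S,t) - a(K,t)] S\<^sup>2 C\<^sub>S\<^sub>S / 2\<close>. Here
  \<open>S C\<^sub>S\<^sub>S = \<phi>(d\<^sub>+) / \<surd>A\<close> blows up like \<open>1 / \<surd>\<tau>\<close> at the strike; but the bracket is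
  bounded by \<open>L \<bar>x\<bar>\<close>, and \<open>x = d\<^sub>+ \<surd>A - r \<tau> - A / 2\<close> with \<open>\<tau> \<le> A / a\<^sub>-\<close> contains a factor
  \<open>\<surd>A\<close>. So the source is bounded, uniformly in \<open>x\<close> and \<open>\<tau>\<close>, and comparison with barriers of the
  form \<open>c \<tau> exp (\<bar>r\<bar> \<tau>)\<close> gives the linear bound.
\<close>

section \<open>The standard normal distribution function\<close>

text \<open>Links the measure-theoretic \<open>cdf\<close> to the gauge integral of the density, so
  that the fundamental theorem of calculus applies. A difference of \<open>cdf\<close> values is the
  mass of a half-open interval, which differs from the closed one by a null set.\<close>

lemma std_normal_cdf_diff:
  assumes "a \<le> b"
  shows "std_normal_cdf b - std_normal_cdf a = integral {a..b} std_normal_density"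
proof (cases "a = b")
  case False
  with assms have "a < b" by simp
  interpret real_distribution std_normal_distribution
    by (rule real_dist_normal_dist)
  have int: "set_integrable lborel A std_normal_density" if "A \<in> sets borel" for A
    unfolding set_integrable_def
    using that integrable_std_normal_moment[of 0] by (intro integrable_mult_indicator) auto
  have "std_normal_cdf b - std_normal_cdf a = measure std_normal_distribution {a<..b}"
    by (rule cdf_diff_eq) fact
  also have "\<dots> = (LINT x : {a<..b} | lborel. std_normal_density x)"
  proof -
    have "emeasure std_normal_distribution {a<..b}
        = (\<integral>\<^sup>+x. ennreal (indicator {a<..b} x *\<^sub>R std_normal_density x) \<partial>lborel)"
      by (subst emeasure_density) (auto intro!: nn_integral_cong split: split_indicator)
    also have "\<dots> = ennreal (LINT x : {a<..b} | lborel. std_normal_density x)"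
      unfolding set_lebesgue_integral_def
      by (rule nn_integral_eq_integral) (use int[unfolded set_integrable_def] in auto)
    finally show ?thesis
      by (simp add: measure_def set_lebesgue_integral_def)
  qed
  also have "\<dots> = integral {a<..b} std_normal_density"
    by (rule set_borel_integral_eq_integral(2)) (rule int, simp)
  also have "\<dots> = integral {a..b} std_normal_density"
    by (rule integral_subset_negligible)
      (auto intro: negligible_subset[OF negligible_sing[of a]])
  finally show ?thesis .
qed simp

lemma std_normal_cdf_has_real_derivative:
  "(std_normal_cdf has_real_derivative std_normal_density x) (at x within X)"
proof -
  \<comment> \<open>The base point \<open>x - 1\<close> puts \<open>x\<close> in the interior of the
    interval, which makes the derivative two-sided.\<close>
  have "((\<lambda>y. integral {x - 1..y} std_normal_density) has_real_derivative std_normal_density x)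
      (at x within {x - 1..x + 1})"
    by (rule integral_has_real_derivative)
      (auto simp: std_normal_density_def intro!: continuous_intros)
  then have "((\<lambda>y. integral {x - 1..y} std_normal_density) has_real_derivative std_normal_density x)
      (at x)"
    by (simp add: at_within_Icc_at)
  then have "((\<lambda>y. std_normal_cdf (x - 1) + integral {x - 1..y} std_normal_density)
      has_real_derivative std_normal_density x) (at x)"
    by (auto intro!: derivative_eq_intros)
  then have "(std_normal_cdf has_real_derivative std_normal_density x) (at x)"
    by (rule has_field_derivative_transform_within_open[where S = "{x - 1<..}"])
      (auto simp: std_normal_cdf_diff[symmetric])
  then show ?thesis
    by (rule DERIV_subset) simp
qed

lemma continuous_on_std_normal_cdf [continuous_intros]:
  "continuous_on X f \<Longrightarrow> continuous_on X (\<lambda>x. std_normal_cdf (f x))"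
  using continuous_on_compose2[of UNIV std_normal_cdf X f]
  by (auto intro: DERIV_continuous_on std_normal_cdf_has_real_derivative)

lemma continuous_on_std_normal_density [continuous_intros]:
  "continuous_on X f \<Longrightarrow> continuous_on X (\<lambda>x. std_normal_density (f x))"
  unfolding std_normal_density_def by (intro continuous_intros) auto

lemma std_normal_density_le: "std_normal_density x \<le> exp (- x\<^sup>2 / 2)"
proof -
  have "1 \<le> sqrt (2 * pi)" using pi_gt3 by (auto intro!: real_le_rsqrt)
  then show ?thesis unfolding std_normal_density_def
    by (intro mult_left_le_one_le) (auto simp: field_simps)
qed

lemma std_normal_cdf_bounds: "0 \<le> std_normal_cdf x" "std_normal_cdf x \<le> 1"
proof -
  interpret real_distribution std_normal_distribution
    by (rule real_dist_normal_dist)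
  show "0 \<le> std_normal_cdf x" "std_normal_cdf x \<le> 1"
    by (rule cdf_nonneg, rule cdf_bounded_prob)
qed

lemma tendsto_std_normal_cdf:
  "(std_normal_cdf \<longlongrightarrow> 1) at_top" "(std_normal_cdf \<longlongrightarrow> 0) at_bot"
proof -
  interpret real_distribution std_normal_distribution
    by (rule real_dist_normal_dist)
  show "(std_normal_cdf \<longlongrightarrow> 1) at_top" "(std_normal_cdf \<longlongrightarrow> 0) at_bot"
    by (rule cdf_lim_at_top_prob, rule cdf_lim_at_bot)
qed

section \<open>The Black-Scholes formula as a function of spot, discounted strike and total
  volatility\<close>

text \<open>
  Here \<open>k\<close> is the discounted strike and \<open>v\<close> the square root of the integrated variance. The value
  at \<open>v = 0\<close> is the limit for \<open>v\<close> tending to 0.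
\<close>

definition bs_call :: "real \<Rightarrow> real \<Rightarrow> real \<Rightarrow> real" where
  "bs_call s k v = (if v = 0 then max (s - k) 0
    else s * std_normal_cdf (ln (s / k) / v + v / 2) - k * std_normal_cdf (ln (s / k) / v - v / 2))"

text \<open>The squares of the two arguments differ by the cross term \<open>2 * ln (s / k)\<close>.
  After halving, its exponential is the ratio \<open>s / k\<close>.\<close>

lemma spot_times_density:
  assumes "0 < s" "0 < k" "0 < v"
  shows "s * std_normal_density (ln (s / k) / v + v / 2)
    = k * std_normal_density (ln (s / k) / v - v / 2)"
proof -
  define l where "l = ln (s / k)"
  have s: "s = k * exp l" using assms by (simp add: l_def)
  have "- (l / v + v / 2)\<^sup>2 / 2 + l = - (l / v - v / 2)\<^sup>2 / 2"
    using assms by (simp add: field_simps power2_eq_square)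
  then have "exp l * exp (- (l / v + v / 2)\<^sup>2 / 2) = exp (- (l / v - v / 2)\<^sup>2 / 2)"
    by (metis exp_add add.commute)
  then show ?thesis
    unfolding l_def[symmetric] std_normal_density_def by (subst s) (simp add: mult_ac)
qed

text \<open>
  The two arguments of the distribution function differ by \<open>v\<close>, so by the preceding
  identity all contributions of their derivatives cancel, except for the one of \<open>v\<close>.
\<close>

lemma bs_call_has_real_derivative:
  assumes s: "(s has_real_derivative s') (at t within X)" "0 < s t"
    and k: "(k has_real_derivative k') (at t within X)" "0 < k t"
    and v: "(v has_real_derivative v') (at t within X)" "0 < v t"
  shows "((\<lambda>t. bs_call (s t) (k t) (v t)) has_real_derivative
      s' * std_normal_cdf (ln (s t / k t) / v t + v t / 2)
      - k' * std_normal_cdf (ln (s t / k t) / v t - v t / 2)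
      + s t * std_normal_density (ln (s t / k t) / v t + v t / 2) * v') (at t within X)"
proof -
  define dm where "dm = (\<lambda>t. ln (s t / k t) / v t - v t / 2)"
  define dp where "dp = (\<lambda>t. dm t + v t)"
  have dp: "dp t = ln (s t / k t) / v t + v t / 2" for t
    by (simp add: dp_def dm_def)
  have "0 < s t / k t" "k t \<noteq> 0" "v t \<noteq> 0" using s k v by auto
  note ln_deriv = DERIV_chain2[OF DERIV_ln DERIV_divide, OF this(1) s(1) k(1) this(2)]
  \<comment> \<open>The derivative \<open>e\<close> stays abstract: it enters only as a multiple of
    the difference of the two sides of \<open>eq\<close> below, which is zero.\<close>
  have "\<exists>e. (dm has_real_derivative e) (at t within X)"
    unfolding dm_def
    by (rule exI)
      (rule DERIV_diff[OF DERIV_divide[OF ln_deriv v(1) \<open>v t \<noteq> 0\<close>] DERIV_cdivide[OF v(1)]])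
  then obtain e where e: "(dm has_real_derivative e) (at t within X)" ..
  have p: "(dp has_real_derivative e + v') (at t within X)"
    unfolding dp_def by (intro DERIV_add e v)
  note chain = DERIV_chain2[OF std_normal_cdf_has_real_derivative]
  have eq: "s t * std_normal_density (dp t) = k t * std_normal_density (dm t)"
    unfolding dp dm_def by (rule spot_times_density) fact+
  have D: "((\<lambda>t. s t * std_normal_cdf (dp t) - k t * std_normal_cdf (dm t)) has_real_derivative
      s' * std_normal_cdf (dp t) - k' * std_normal_cdf (dm t)
      + s t * std_normal_density (dp t) * v') (at t within X)"
    by (rule DERIV_cong[OF DERIV_diff[OF DERIV_mult[OF s(1) chain[OF p]]
            DERIV_mult[OF k(1) chain[OF e]]]])
      (use eq in algebra)
  \<comment> \<open>Continuity keeps \<open>v\<close> positive near \<open>t\<close>, so the branch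
    \<open>v = 0\<close> of \<open>bs_call\<close> is not met there.\<close>
  have "eventually (\<lambda>t. v t > 0) (at t within X)"
    using DERIV_continuous[OF v(1)] v(2) unfolding continuous_within
    by (rule order_tendstoD)
  then have "eventually (\<lambda>t. bs_call (s t) (k t) (v t)
      = s t * std_normal_cdf (dp t) - k t * std_normal_cdf (dm t)) (at t within X)"
    by eventually_elim (simp add: bs_call_def dp dm_def)
  from has_field_derivative_cong_eventually[OF this] D show ?thesis
    using v(2) by (simp add: bs_call_def dp dm_def)
qed

text \<open>The sign of \<open>ln (s / k)\<close> decides. Out of the money both arguments tend to
  minus infinity, in the money both tend to plus infinity. At the money both tend to 0, and the two
  terms cancel because the spot equals the strike.\<close>

lemma bs_call_tendsto_0:
  assumes "0 < s" "0 < k"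
  shows "((\<lambda>v. bs_call s k v) \<longlongrightarrow> max (s - k) 0) (at_right 0)"
proof -
  have "((\<lambda>v. s * std_normal_cdf (ln (s / k) / v + v / 2)
      - k * std_normal_cdf (ln (s / k) / v - v / 2)) \<longlongrightarrow> max (s - k) 0) (at_right 0)"
  proof (cases s k rule: linorder_cases)
    case less
    with assms have "ln (s / k) < 0" by simp
    then have "filterlim (\<lambda>v. ln (s / k) / v + v / 2) at_bot (at_right 0)"
      "filterlim (\<lambda>v. ln (s / k) / v - v / 2) at_bot (at_right 0)"
      by real_asymp+
    from this[THEN filterlim_compose[OF tendsto_std_normal_cdf(2)]]
    have "((\<lambda>v. s * std_normal_cdf (ln (s / k) / v + v / 2)
        - k * std_normal_cdf (ln (s / k) / v - v / 2)) \<longlongrightarrow> s * 0 - k * 0) (at_right 0)"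
      by (intro tendsto_intros)
    then show ?thesis using less by simp
  next
    case equal
    have "((\<lambda>v. s * std_normal_cdf (v / 2) - s * std_normal_cdf (- (v / 2)))
       \<longlongrightarrow> s * std_normal_cdf (0 / 2) - s * std_normal_cdf (- (0 / 2))) (at_right 0)"
      by (intro tendsto_intros
          isCont_tendsto_compose[OF DERIV_isCont[OF std_normal_cdf_has_real_derivative]]) auto
    then show ?thesis using equal assms by simp
  next
    case greater
    with assms have "ln (s / k) > 0" by simp
    then have "filterlim (\<lambda>v. ln (s / k) / v + v / 2) at_top (at_right 0)"
      "filterlim (\<lambda>v. ln (s / k) / v - v / 2) at_top (at_right 0)"
      by real_asymp+
    from this[THEN filterlim_compose[OF tendsto_std_normal_cdf(1)]]
    have "((\<lambda>v. s * std_normal_cdf (ln (s / k) / v + v / 2)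
        - k * std_normal_cdf (ln (s / k) / v - v / 2)) \<longlongrightarrow> s * 1 - k * 1) (at_right 0)"
      by (intro tendsto_intros)
    then show ?thesis using greater by simp
  qed
  then show ?thesis
    by (rule Lim_transform_eventually)
      (auto simp: bs_call_def eventually_at_right_field intro!: exI[of _ 1])
qed

text \<open>The spot derivative is a value of the distribution function, hence in [0,1]. This and
  the next two lemmas give Lipschitz bounds that include \<open>v = 0\<close>; near maturity they
  replace an analysis of the singular quotient \<open>ln (s / k) / v\<close>.\<close>

lemma bs_call_diff_spot:
  assumes "0 < s" "0 < s'" "0 < k" "0 \<le> v"
  shows "\<bar>bs_call s k v - bs_call s' k v\<bar> \<le> \<bar>s - s'\<bar>"
proof (cases "v = 0")
  case False
  with assms have v: "v > 0" by simp
  have "norm (bs_call s k v - bs_call s' k v) \<le> 1 * norm (s - s')"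
  proof (rule field_differentiable_bound[where S = "{0<..}"])
    show "((\<lambda>s. bs_call s k v) has_real_derivative std_normal_cdf (ln (z / k) / v + v / 2))
        (at z within {0<..})" if "z \<in> {0<..}" for z
      using bs_call_has_real_derivative[of "\<lambda>z. z" 1 z "{0<..}" "\<lambda>_. k" 0 "\<lambda>_. v" 0] that assms v
      by simp
  qed (use assms std_normal_cdf_bounds in \<open>auto simp: abs_of_nonneg\<close>)
  then show ?thesis by simp
qed (auto simp: bs_call_def)

lemma bs_call_diff_strike:
  assumes "0 < s" "0 < k" "0 < k'" "0 \<le> v"
  shows "\<bar>bs_call s k v - bs_call s k' v\<bar> \<le> \<bar>k - k'\<bar>"
proof (cases "v = 0")
  case False
  with assms have v: "v > 0" by simp
  have "norm (bs_call s k v - bs_call s k' v) \<le> 1 * norm (k - k')"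
  proof (rule field_differentiable_bound[where S = "{0<..}"])
    show "((\<lambda>k. bs_call s k v) has_real_derivative - std_normal_cdf (ln (s / z) / v - v / 2))
        (at z within {0<..})" if "z \<in> {0<..}" for z
      using bs_call_has_real_derivative[of "\<lambda>_. s" 0 z "{0<..}" "\<lambda>z. z" 1 "\<lambda>_. v" 0] that assms v
      by simp
  qed (use assms std_normal_cdf_bounds in \<open>auto simp: abs_of_nonneg\<close>)
  then show ?thesis by simp
qed (auto simp: bs_call_def)

text \<open>By the cancellation above, the volatility derivative is the spot times a density value,
  and the density is at most 1.\<close>

lemma bs_call_diff_vol:
  assumes "0 < s" "0 < k" "0 \<le> v" "0 \<le> v'"
  shows "\<bar>bs_call s k v - bs_call s k v'\<bar> \<le> s * \<bar>v - v'\<bar>"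
proof -
  have pos: "\<bar>bs_call s k v - bs_call s k v'\<bar> \<le> s * \<bar>v - v'\<bar>" if "0 < v" "0 < v'" for v v'
  proof -
    have "norm (bs_call s k v - bs_call s k v') \<le> s * norm (v - v')"
    proof (rule field_differentiable_bound[where S = "{0<..}"])
      fix z :: real assume z: "z \<in> {0<..}"
      show "((\<lambda>v. bs_call s k v) has_real_derivative
          s * std_normal_density (ln (s / k) / z + z / 2)) (at z within {0<..})"
        using bs_call_has_real_derivative[of "\<lambda>_. s" 0 z "{0<..}" "\<lambda>_. k" 0 "\<lambda>z. z" 1] z assms
        by simp
      have "std_normal_density y \<le> 1" for y
        by (rule order.trans[OF std_normal_density_le]) auto
      then show "norm (s * std_normal_density (ln (s / k) / z + z / 2)) \<le> s"
        using assms by (auto simp: abs_mult intro!: mult_right_le_one_le)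
    qed (use that in auto)
    then show ?thesis by simp
  qed
  \<comment> \<open>The derivative formula requires positive volatility, so the endpoint 0 is
    reached by letting \<open>u\<close> tend to 0 in the estimate just proved.\<close>
  have zero: "\<bar>bs_call s k v - bs_call s k 0\<bar> \<le> s * \<bar>v\<bar>" if "0 < v" for v
  proof -
    have lim: "((\<lambda>u. \<bar>bs_call s k v - bs_call s k u\<bar>) \<longlongrightarrow> \<bar>bs_call s k v - bs_call s k 0\<bar>) (at_right 0)"
      using bs_call_tendsto_0[OF assms(1,2)] by (intro tendsto_intros) (simp add: bs_call_def)
    have lim': "((\<lambda>u. s * \<bar>v - u\<bar>) \<longlongrightarrow> s * \<bar>v - 0\<bar>) (at_right 0)"
      by (intro tendsto_intros)
    have "\<forall>\<^sub>F u in at_right 0. \<bar>bs_call s k v - bs_call s k u\<bar> \<le> s * \<bar>v - u\<bar>"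
      using pos[OF that] by (auto simp: eventually_at_right_field intro!: exI[of _ 1])
    from tendsto_le[OF _ lim' lim this] show ?thesis by simp
  qed
  consider "0 < v" "0 < v'" | "v = 0" "0 < v'" | "0 < v" "v' = 0" | "v = 0" "v' = 0"
    using assms by linarith
  then show ?thesis
    by cases (use pos zero zero[of v'] zero[of v] in \<open>auto simp: abs_minus_commute\<close>)
qed

text \<open>One argument is changed at a time, the volatility last; hence the factor
  \<open>s'\<close>.\<close>

lemma bs_call_diff_le:
  assumes "0 < s" "0 < s'" "0 < k" "0 < k'" "0 \<le> v" "0 \<le> v'"
  shows "\<bar>bs_call s k v - bs_call s' k' v'\<bar> \<le> \<bar>s - s'\<bar> + \<bar>k - k'\<bar> + s' * \<bar>v - v'\<bar>"
  using bs_call_diff_spot[of s s' k v] bs_call_diff_strike[of s' k k' v]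
    bs_call_diff_vol[of s' k' v v'] assms by linarith

lemma abs_bs_call_le:
  assumes "0 < s" "0 < k"
  shows "\<bar>bs_call s k v\<bar> \<le> s + k"
proof (cases "v = 0")
  case False
  define p q where "p = std_normal_cdf (ln (s / k) / v + v / 2)"
    and "q = std_normal_cdf (ln (s / k) / v - v / 2)"
  have "0 \<le> s * p" "s * p \<le> s" "0 \<le> k * q" "k * q \<le> k"
    using assms std_normal_cdf_bounds by (auto simp: p_def q_def intro!: mult_right_le_one_le)
  then show ?thesis using False unfolding bs_call_def p_def[symmetric] q_def[symmetric] by auto
qed (use assms in \<open>auto simp: bs_call_def\<close>)

lemma bs_call_spot_derivatives:
  assumes "0 < s" "0 < k" "0 < v"
  shows "((\<lambda>s. bs_call s k v) has_real_derivative std_normal_cdf (ln (s / k) / v + v / 2)) (at s)"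
    and "((\<lambda>s. std_normal_cdf (ln (s / k) / v + v / 2)) has_real_derivative
      std_normal_density (ln (s / k) / v + v / 2) / (s * v)) (at s)"
proof -
  show "((\<lambda>s. bs_call s k v) has_real_derivative std_normal_cdf (ln (s / k) / v + v / 2)) (at s)"
    using bs_call_has_real_derivative[of "\<lambda>z. z" 1 s UNIV "\<lambda>_. k" 0 "\<lambda>_. v" 0] assms by simp
  have "((\<lambda>s. ln (s / k) / v + v / 2) has_real_derivative 1 / (s * v)) (at s)"
    using assms by (auto intro!: derivative_eq_intros simp: field_simps)
  from DERIV_chain2[OF std_normal_cdf_has_real_derivative this]
  show "((\<lambda>s. std_normal_cdf (ln (s / k) / v + v / 2)) has_real_derivative
      std_normal_density (ln (s / k) / v + v / 2) / (s * v)) (at s)" by simp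
qed

text \<open>Rationalise: the sum of the two roots is at least \<open>sqrt c\<close>. This serves for
  times bounded away from maturity, since the square root is not Lipschitz at 0.\<close>

lemma abs_sqrt_diff_le:
  assumes "0 < c" "c \<le> x" "c \<le> y"
  shows "\<bar>sqrt x - sqrt y\<bar> \<le> \<bar>x - y\<bar> / sqrt c"
proof -
  have "sqrt c \<le> sqrt x + sqrt y"
    using assms real_sqrt_le_mono[of c x] real_sqrt_ge_zero[of y] by linarith
  then have "\<bar>sqrt x - sqrt y\<bar> * sqrt c \<le> \<bar>sqrt x - sqrt y\<bar> * \<bar>sqrt x + sqrt y\<bar>"
    by (intro mult_left_mono) auto
  also have "\<dots> = \<bar>(sqrt x - sqrt y) * (sqrt x + sqrt y)\<bar>"
    by (rule abs_mult[symmetric])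
  also have "(sqrt x - sqrt y) * (sqrt x + sqrt y) = x - y"
    using assms by (simp add: algebra_simps)
  finally show ?thesis
    using assms by (simp add: pos_le_divide_eq)
qed

section \<open>Barriers, the growth class, comparison, and a Gaussian estimate\<close>

text \<open>The barrier does not depend on the spot, so the operator reduces to the time derivative
  plus \<open>r\<close> times the function, whatever the coefficient \<open>a\<close> and the set
  \<open>Z\<close> are.\<close>

lemma classical_solution_barrier:
  assumes "0 \<le> \<rho>" "0 < T"
  shows "classical_solution Z a r T
    (\<lambda>S t. c * exp (\<rho> * (T - t)) * (1 + (\<rho> + r) * (T - t))) (\<lambda>S. 0)
    (\<lambda>S t. c * (T - t) * exp (\<rho> * (T - t)))"
proof -
  let ?u = "\<lambda>t. c * (T - t) * exp (\<rho> * (T - t))"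
  let ?u' = "\<lambda>t. - (c * exp (\<rho> * (T - t)) * (1 + \<rho> * (T - t)))"
  have D: "(?u has_real_derivative ?u' t) (at t within X)" for t X
    by (auto intro!: derivative_eq_intros simp: algebra_simps)
  have lip: "(\<bar>c\<bar> * exp (\<rho> * T) * (1 + \<rho> * T))-lipschitz_on {0..s} ?u" if "s < T" for s
  proof (rule lipschitz_onI)
    have bound: "norm (?u' t) \<le> \<bar>c\<bar> * exp (\<rho> * T) * (1 + \<rho> * T)" if "t \<in> {0..s}" for t
    proof -
      have "0 \<le> \<rho> * (T - t)" "\<rho> * (T - t) \<le> \<rho> * T"
        using that assms \<open>s < T\<close> by (auto intro!: mult_left_mono)
      then show ?thesis
        by (auto simp: abs_mult intro!: mult_mono)
    qed
    show "dist (?u x) (?u y) \<le> (\<bar>c\<bar> * exp (\<rho> * T) * (1 + \<rho> * T)) * dist x y"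
      if "x \<in> {0..s}" "y \<in> {0..s}" for x y
      unfolding dist_norm
      by (rule field_differentiable_bound[OF convex_real_interval(5) D bound that])
  qed (use assms in auto)
  show ?thesis
    unfolding classical_solution_def
  proof (intro conjI allI impI)
    show "continuous_on ({0<..} \<times> {0..T}) (\<lambda>(S :: real, t). ?u t)"
      unfolding case_prod_beta by (intro continuous_intros)
    show "\<exists>L. \<forall>S\<in>{p..q :: real}. L-lipschitz_on {0..s} ?u" if "s < T" for p q s
      using lip[OF that] by blast
    show "\<exists>uS uSS. continuous_on ({0<..} \<times> {0..<T}) (\<lambda>(S, t). uS S t) \<and>
      continuous_on ({0<..} \<times> {0..<T}) (\<lambda>(S, t). uSS S t) \<and>
      (\<forall>S>0. \<forall>t\<in>{0..<T}.
        ((\<lambda>s. ?u t) has_real_derivative uS S t) (at S) \<and>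
        ((\<lambda>s. uS s t) has_real_derivative uSS S t) (at S) \<and>
        (t \<notin> Z \<longrightarrow>
          (\<exists>ut. (?u has_real_derivative ut) (at t within {0..T}) \<and>
            ut + 1 / 2 * a S t * S\<^sup>2 * uSS S t + r * S * uS S t - r * ?u t
              + c * exp (\<rho> * (T - t)) * (1 + (\<rho> + r) * (T - t)) = 0)))"
    proof (rule exI[of _ "\<lambda>_ _. 0"], rule exI[of _ "\<lambda>_ _. 0"], intro conjI allI ballI impI)
      show "\<exists>ut. (?u has_real_derivative ut) (at t within {0..T}) \<and>
          ut + 1 / 2 * a S t * S\<^sup>2 * 0 + r * S * 0 - r * ?u t
            + c * exp (\<rho> * (T - t)) * (1 + (\<rho> + r) * (T - t)) = 0" for S t
        by (intro exI conjI, rule D) (simp add: algebra_simps)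
    qed auto
  qed auto
qed

lemma exp_growth_diff:
  assumes "exp_growth K T u" "exp_growth K T v"
  shows "exp_growth K T (\<lambda>S t. u S t - v S t)"
proof -
  from assms obtain M m M' m' where
    u: "\<And>x \<tau>. \<tau> \<in> {0..T} \<Longrightarrow> \<bar>u (K * exp x) (T - \<tau>)\<bar> \<le> M * exp (m * \<bar>x\<bar>)" and
    v: "\<And>x \<tau>. \<tau> \<in> {0..T} \<Longrightarrow> \<bar>v (K * exp x) (T - \<tau>)\<bar> \<le> M' * exp (m' * \<bar>x\<bar>)"
    unfolding exp_growth_def by blast
  show ?thesis
    unfolding exp_growth_def
  proof (intro exI allI ballI)
    fix x \<tau> :: real assume \<tau>: "\<tau> \<in> {0..T}"
    \<comment> \<open>The growth constants carry no sign condition, hence the absolute value on the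
      right.\<close>
    have le: "N * exp (n * \<bar>x\<bar>) \<le> \<bar>N\<bar> * exp (max m m' * \<bar>x\<bar>)" if "n \<le> max m m'" for N n :: real
      using that by (intro mult_mono) (auto intro!: mult_right_mono)
    show "\<bar>u (K * exp x) (T - \<tau>) - v (K * exp x) (T - \<tau>)\<bar>
        \<le> (\<bar>M\<bar> + \<bar>M'\<bar>) * exp (max m m' * \<bar>x\<bar>)"
      using u[OF \<tau>, of x] v[OF \<tau>, of x] le[of m M] le[of m' M']
      unfolding distrib_right by linarith
  qed
qed

lemma exp_growth_barrier:
  assumes "0 \<le> \<rho>"
  shows "exp_growth K T (\<lambda>S t. c * (T - t) * exp (\<rho> * (T - t)))"
  unfolding exp_growth_def
proof (intro exI allI ballI)
  fix x \<tau> :: real assume "\<tau> \<in> {0..T}"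
  then show "\<bar>c * (T - (T - \<tau>)) * exp (\<rho> * (T - (T - \<tau>)))\<bar> \<le> (\<bar>c\<bar> * T * exp (\<rho> * T)) * exp (0 * \<bar>x\<bar>)"
    using assms by (auto simp: abs_mult intro!: mult_mono mult_left_mono)
qed

text \<open>The solution is squeezed between the barriers with \<open>c = N\<close> and
  \<open>c = - N\<close>. With the rate \<open>\<bar>r\<bar>\<close> in the exponent, the term
  \<open>\<bar>r\<bar> + r\<close> is nonnegative even for a negative rate, so the barrier sources
  dominate \<open>N\<close> and \<open>- N\<close>.\<close>

lemma abs_solution_le:
  assumes sol: "consistent sol Z a K T r" "comparison_principle sol a K T r"
    and w: "exp_growth K T w" "sol a r T F (\<lambda>S. 0) w"
    and F: "\<And>S t. 0 < S \<Longrightarrow> t \<in> {0..<T} \<Longrightarrow> \<bar>F S t\<bar> \<le> N"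
    and "0 \<le> N" "0 < T" "0 < S" "t \<in> {0..T}"
  shows "\<bar>w S t\<bar> \<le> N * (T - t) * exp (\<bar>r\<bar> * (T - t))"
proof -
  define v where "v = (\<lambda>c (S :: real) t. c * (T - t) * exp (\<bar>r\<bar> * (T - t)))"
  define G where "G = (\<lambda>c (S :: real) t. c * exp (\<bar>r\<bar> * (T - t)) * (1 + (\<bar>r\<bar> + r) * (T - t)))"
  have growth: "exp_growth K T (v c)" for c
    unfolding v_def by (rule exp_growth_barrier) simp
  have v: "sol a r T (G c) (\<lambda>S. 0) (v c)" for c
    using classical_solution_barrier[of "\<bar>r\<bar>" T Z a r c] growth[of c] sol(1) \<open>0 < T\<close>
    unfolding consistent_def v_def G_def by simp
  have G: "N \<le> G N S t" "G (- N) S t = - G N S t" if "t \<in> {0..<T}" for S t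
  proof -
    have "1 * 1 \<le> exp (\<bar>r\<bar> * (T - t)) * (1 + (\<bar>r\<bar> + r) * (T - t))"
      using that by (intro mult_mono) (auto intro!: mult_nonneg_nonneg)
    from mult_left_mono[OF this \<open>0 \<le> N\<close>] show "N \<le> G N S t"
      by (simp add: G_def mult_ac)
    show "G (- N) S t = - G N S t" by (simp add: G_def)
  qed
  have le: "F S t \<le> G N S t" "G (- N) S t \<le> F S t" if "0 < S" "t \<in> {0..<T}" for S t
    using F[OF that] G[OF that(2), of S] by linarith+
  have "w S t \<le> v N S t" "v (- N) S t \<le> w S t"
    using sol(2)[unfolded comparison_principle_def, rule_format, of w F "\<lambda>S. 0" "v N" "G N" "\<lambda>S. 0" S t]
      sol(2)[unfolded comparison_principle_def, rule_format, of "v (- N)" "G (- N)" "\<lambda>S. 0" w F "\<lambda>S. 0" S t]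
      w growth v le assms by auto
  then show ?thesis by (simp add: v_def)
qed

text \<open>
  Completing the square: the Gaussian factor absorbs both the exponential \<open>exp (v * d)\<close> coming from
  the spot and the linear factor \<open>\<bar>d\<bar>\<close> coming from the log-moneyness.
\<close>

lemma gaussian_absorbs:
  fixes b d e :: real
  assumes "0 \<le> e"
  shows "exp (b * \<bar>d\<bar>) * std_normal_density d * (\<bar>d\<bar> + e) \<le> (1 + e) * exp ((b + 1)\<^sup>2 / 2)"
proof -
  have "exp (b * \<bar>d\<bar>) * std_normal_density d * (\<bar>d\<bar> + e)
      \<le> exp (b * \<bar>d\<bar>) * exp (- d\<^sup>2 / 2) * ((1 + e) * exp \<bar>d\<bar>)"
  proof (intro mult_mono mult_left_mono std_normal_density_le)
    have "\<bar>d\<bar> + e * 1 \<le> exp \<bar>d\<bar> + e * exp \<bar>d\<bar>"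
      using assms exp_ge_add_one_self[of "\<bar>d\<bar>"]
      by (intro add_mono mult_left_mono) (linarith | simp)+
    then show "\<bar>d\<bar> + e \<le> (1 + e) * exp \<bar>d\<bar>" by (simp add: algebra_simps)
  qed (use assms in auto)
  also have "\<dots> = (1 + e) * exp (b * \<bar>d\<bar> + - d\<^sup>2 / 2 + \<bar>d\<bar>)"
    by (simp only: exp_add mult_ac)
  also have "\<dots> \<le> (1 + e) * exp ((b + 1)\<^sup>2 / 2)"
  proof (intro mult_left_mono)
    have "0 \<le> (\<bar>d\<bar> - (b + 1))\<^sup>2" by simp
    then show "exp (b * \<bar>d\<bar> + - d\<^sup>2 / 2 + \<bar>d\<bar>) \<le> exp ((b + 1)\<^sup>2 / 2)"
      by (simp add: power2_eq_square algebra_simps)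
  qed (use assms in auto)
  finally show ?thesis .
qed

section \<open>The carrier of one fixed contract\<close>

text \<open>The constants \<open>a_lo\<close>, \<open>a_hi\<close> and \<open>L\<close> are
  parameters that all contracts will share, so that the dependence of the estimates on the contract
  remains visible. The assumption \<open>integrable\<close> ensures that \<open>strike_var\<close>
  is a true integral and not the default value 0.\<close>

locale bounded_variance =
  fixes a :: "real \<Rightarrow> real \<Rightarrow> real" and K T r a_lo a_hi L :: real and Z :: "real set"
  assumes K_pos: "0 < K" and T_pos: "0 < T" and a_lo_pos: "0 < a_lo"
    and integrable: "(\<lambda>u. a K (T - u)) integrable_on {0..T}"
    and exceptional: "exceptional_times a K T Z"
    and bounds: "\<tau> \<in> {0..T} \<Longrightarrow> a_lo \<le> log_var a K T x \<tau> \<and> log_var a K T x \<tau> \<le> a_hi"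
    and lipschitz: "\<tau> \<in> {0..T} \<Longrightarrow> L-lipschitz_on UNIV (\<lambda>x. log_var a K T x \<tau>)"
begin

abbreviation disc :: "real \<Rightarrow> real" where
  "disc t \<equiv> K * exp (- r * (T - t))"

abbreviation vol :: "real \<Rightarrow> real" where
  "vol t \<equiv> sqrt (strike_var a K T (T - t))"

abbreviation dplus :: "real \<Rightarrow> real \<Rightarrow> real" where
  "dplus S t \<equiv> ln (S / disc t) / vol t + vol t / 2"

lemma a_hi_pos: "0 < a_hi"
  using bounds[of 0 0] T_pos a_lo_pos by auto

lemma strike_var_diff:
  assumes "0 \<le> s" "s \<le> \<tau>" "\<tau> \<le> T"
  shows "a_lo * (\<tau> - s) \<le> strike_var a K T \<tau> - strike_var a K T s"
    and "strike_var a K T \<tau> - strike_var a K T s \<le> a_hi * (\<tau> - s)"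
proof -
  have int: "(\<lambda>u. a K (T - u)) integrable_on {p..q}" if "0 \<le> p" "q \<le> T" for p q
    by (rule integrable_on_subinterval[OF integrable]) (use that in auto)
  have eq: "strike_var a K T \<tau> - strike_var a K T s = integral {s..\<tau>} (\<lambda>u. a K (T - u))"
    unfolding strike_var_def
    using Henstock_Kurzweil_Integration.integral_combine[of 0 s \<tau> "\<lambda>u. a K (T - u)"]
      int[of 0 \<tau>] assms by simp
  have b: "a_lo \<le> a K (T - u)" "a K (T - u) \<le> a_hi" if "u \<in> {s..\<tau>}" for u
    using bounds[of u 0] that assms by (auto simp: log_var_def)
  have "integral {s..\<tau>} (\<lambda>u. a_lo) \<le> integral {s..\<tau>} (\<lambda>u. a K (T - u))"
    by (rule integral_le) (use assms int b in auto)
  moreover have "integral {s..\<tau>} (\<lambda>u. a K (T - u)) \<le> integral {s..\<tau>} (\<lambda>u. a_hi)"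
    by (rule integral_le) (use assms int b in auto)
  ultimately show "a_lo * (\<tau> - s) \<le> strike_var a K T \<tau> - strike_var a K T s"
    "strike_var a K T \<tau> - strike_var a K T s \<le> a_hi * (\<tau> - s)"
    using assms by (simp_all add: eq mult.commute)
qed

lemma strike_var_bounds:
  assumes "0 \<le> \<tau>" "\<tau> \<le> T"
  shows "a_lo * \<tau> \<le> strike_var a K T \<tau>" "strike_var a K T \<tau> \<le> a_hi * \<tau>"
  using strike_var_diff[of 0 \<tau>] assms by (auto simp: strike_var_def)

lemma strike_var_nonneg: "0 \<le> \<tau> \<Longrightarrow> \<tau> \<le> T \<Longrightarrow> 0 \<le> strike_var a K T \<tau>"
  using strike_var_bounds(1)[of \<tau>] a_lo_pos by (meson mult_nonneg_nonneg less_imp_le order_trans)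

lemma strike_var_pos: "0 < \<tau> \<Longrightarrow> \<tau> \<le> T \<Longrightarrow> 0 < strike_var a K T \<tau>"
  using strike_var_bounds(1)[of \<tau>] mult_pos_pos[OF a_lo_pos, of \<tau>] by simp

text \<open>The variance need not be continuous in time. This Lipschitz bound supplies the
  regularity in time of the carrier.\<close>

lemma abs_strike_var_diff_le:
  assumes "s \<in> {0..T}" "\<tau> \<in> {0..T}"
  shows "\<bar>strike_var a K T \<tau> - strike_var a K T s\<bar> \<le> a_hi * \<bar>\<tau> - s\<bar>"
proof -
  have le: "\<bar>strike_var a K T q - strike_var a K T p\<bar> \<le> a_hi * \<bar>q - p\<bar>"
    if "p \<in> {0..T}" "q \<in> {0..T}" "p \<le> q" for p q
  proof -
    have "0 \<le> a_lo * (q - p)" "\<bar>q - p\<bar> = q - p" using that a_lo_pos by auto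
    moreover have "a_lo * (q - p) \<le> strike_var a K T q - strike_var a K T p"
      "strike_var a K T q - strike_var a K T p \<le> a_hi * (q - p)"
      using strike_var_diff[of p q] that by auto
    ultimately show ?thesis by (metis abs_of_nonneg order_trans)
  qed
  show ?thesis
    using le[of s \<tau>] le[of \<tau> s] assms by (cases "s \<le> \<tau>") (auto simp: abs_minus_commute)
qed

lemma vol_nonneg: "t \<in> {0..T} \<Longrightarrow> 0 \<le> vol t"
  using strike_var_nonneg[of "T - t"] by auto

lemma vol_pos: "t \<in> {0..<T} \<Longrightarrow> 0 < vol t"
  using strike_var_pos[of "T - t"] by auto

lemma continuous_on_strike_var:
  assumes "continuous_on X f" "f ` X \<subseteq> {0..T}"
  shows "continuous_on X (\<lambda>x. strike_var a K T (T - f x))"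
proof (rule continuous_on_compose2[of "{0..T}" "strike_var a K T"])
  show "continuous_on {0..T} (strike_var a K T)"
    by (rule lipschitz_on_continuous_on[where L = a_hi], rule lipschitz_onI)
      (use abs_strike_var_diff_le a_hi_pos in \<open>auto simp: dist_real_def\<close>)
qed (use assms in \<open>auto intro!: continuous_intros\<close>)

text \<open>The logarithm of the discount factor is the term \<open>r * \<tau>\<close> in the
  numerators of \<open>C_ref\<close>, so the rate can be absorbed into the strike. At maturity the
  integrated variance is 0, and the branch \<open>v = 0\<close> of \<open>bs_call\<close> is the
  payoff.\<close>

lemma C_ref_eq:
  assumes "0 < S" "t \<in> {0..T}"
  shows "C_ref a K T r S t = bs_call S (disc t) (vol t)"
proof (cases "t = T")
  case True
  then show ?thesis by (simp add: C_ref_def bs_call_def strike_var_def)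
next
  case False
  then have "t \<in> {0..<T}" using assms by auto
  from vol_pos[OF this] have v: "0 < vol t" .
  then have A: "strike_var a K T (T - t) / vol t = vol t"
    by (simp add: real_div_sqrt)
  have "ln (S / disc t) = ln (S / K) + r * (T - t)"
    using assms K_pos by (simp add: ln_div ln_mult)
  then have "dplus S t = (ln (S / K) + r * (T - t) + strike_var a K T (T - t) / 2) / vol t"
    "ln (S / disc t) / vol t - vol t / 2
      = (ln (S / K) + r * (T - t) - strike_var a K T (T - t) / 2) / vol t"
    using A by (auto simp: add_divide_distrib diff_divide_distrib)
  then show ?thesis
    using False v assms by (simp add: C_ref_def bs_call_def Let_def)
qed

lemma disc_le: "t \<in> {0..T} \<Longrightarrow> disc t \<le> K * exp (\<bar>r\<bar> * T)"
proof -
  assume t: "t \<in> {0..T}"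
  have "- r * (T - t) \<le> \<bar>r\<bar> * (T - t)" using t by (intro mult_right_mono) auto
  also have "\<dots> \<le> \<bar>r\<bar> * T" using t by (intro mult_left_mono) auto
  finally show ?thesis using K_pos by simp
qed

lemma disc_has_real_derivative: "(disc has_real_derivative r * disc t) (at t within X)"
  by (auto intro!: derivative_eq_intros)

lemma disc_diff_le:
  assumes "s \<in> {0..T}" "t \<in> {0..T}"
  shows "\<bar>disc s - disc t\<bar> \<le> (\<bar>r\<bar> * (K * exp (\<bar>r\<bar> * T))) * \<bar>s - t\<bar>"
proof -
  have "norm (r * disc t) \<le> \<bar>r\<bar> * (K * exp (\<bar>r\<bar> * T))" if "t \<in> {0..T}" for t
    using disc_le[OF that] K_pos by (auto simp: abs_mult intro!: mult_left_mono)
  from field_differentiable_bound[OF convex_real_interval(5) disc_has_real_derivative this assms]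
  show ?thesis by simp
qed

text \<open>Composing continuous functions fails at maturity, where the volatility in the
  denominator vanishes. The majorant of \<open>bs_call_diff_le\<close> tends to 0 at every point,
  maturity included.\<close>

lemma continuous_on_C_ref:
  "continuous_on ({0<..} \<times> {0..T}) (\<lambda>(S, t). C_ref a K T r S t)"
proof -
  let ?X = "{0<..} \<times> {0..T} :: (real \<times> real) set"
  let ?f = "\<lambda>z. bs_call (fst z) (disc (snd z)) (vol (snd z))"
  have "continuous_on ?X ?f"
    unfolding continuous_on_def
  proof
    fix z assume z: "z \<in> ?X"
    let ?F = "at z within ?X"
    have "continuous_on ?X (\<lambda>y. vol (snd y))"
      by (intro continuous_on_real_sqrt continuous_on_strike_var continuous_on_snd) auto
    then have vol: "((\<lambda>y. vol (snd y)) \<longlongrightarrow> vol (snd z)) ?F"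
      using z unfolding continuous_on_def by blast
    have "((\<lambda>y. \<bar>fst y - fst z\<bar> + \<bar>disc (snd y) - disc (snd z)\<bar>
        + fst z * \<bar>vol (snd y) - vol (snd z)\<bar>) \<longlongrightarrow>
      \<bar>fst z - fst z\<bar> + \<bar>disc (snd z) - disc (snd z)\<bar>
        + fst z * \<bar>vol (snd z) - vol (snd z)\<bar>) ?F"
      by (intro tendsto_add tendsto_mult tendsto_const tendsto_rabs tendsto_diff vol
          tendsto_fst tendsto_snd tendsto_exp tendsto_ident_at)
    then have lim: "((\<lambda>y. \<bar>fst y - fst z\<bar> + \<bar>disc (snd y) - disc (snd z)\<bar>
        + fst z * \<bar>vol (snd y) - vol (snd z)\<bar>) \<longlongrightarrow> 0) ?F"
      by simp
    have "\<forall>\<^sub>F y in ?F. norm (?f y - ?f z) \<le> \<bar>fst y - fst z\<bar> + \<bar>disc (snd y) - disc (snd z)\<bar>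
        + fst z * \<bar>vol (snd y) - vol (snd z)\<bar>"
      unfolding eventually_at_filter
    proof (rule always_eventually, intro allI impI)
      fix y assume "y \<in> ?X"
      with z K_pos vol_nonneg show "norm (?f y - ?f z) \<le> \<bar>fst y - fst z\<bar>
        + \<bar>disc (snd y) - disc (snd z)\<bar> + fst z * \<bar>vol (snd y) - vol (snd z)\<bar>"
        unfolding real_norm_def by (intro bs_call_diff_le) auto
    qed
    from Lim_null_comparison[OF this lim] show "(?f \<longlongrightarrow> ?f z) ?F"
      by (rule LIM_zero_cancel)
  qed
  then show ?thesis
    by (rule continuous_on_eq) (auto simp: C_ref_eq)
qed

text \<open>Up to time \<open>s\<close> the integrated variance is at least
  \<open>a_lo * (T - s)\<close>, so \<open>vol\<close> is Lipschitz there. The two summands come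
  from the discounted strike and from the volatility. The constant blows up as \<open>s\<close>
  tends to \<open>T\<close>, which \<open>classical_solution\<close> permits.\<close>

lemma C_ref_lipschitz_time:
  assumes "s < T" "0 < S" "S \<le> q"
  shows "(\<bar>r\<bar> * (K * exp (\<bar>r\<bar> * T)) + q * (a_hi / sqrt (a_lo * (T - s))))-lipschitz_on {0..s}
    (C_ref a K T r S)"
proof (rule lipschitz_onI)
  let ?c = "a_lo * (T - s)"
  have c: "0 < ?c" using assms a_lo_pos by simp
  show "0 \<le> \<bar>r\<bar> * (K * exp (\<bar>r\<bar> * T)) + q * (a_hi / sqrt ?c)"
    using assms K_pos a_hi_pos c by auto
  fix t u assume tu: "t \<in> {0..s}" "u \<in> {0..s}"
  then have mem: "t \<in> {0..T}" "u \<in> {0..T}" using assms by auto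
  have ge: "?c \<le> strike_var a K T (T - w)" if "w \<in> {0..s}" for w
  proof -
    have "?c \<le> a_lo * (T - w)"
      using that a_lo_pos by (intro mult_left_mono) auto
    also have "\<dots> \<le> strike_var a K T (T - w)"
      by (rule strike_var_bounds) (use that assms in auto)
    finally show ?thesis .
  qed
  have "\<bar>vol t - vol u\<bar> \<le> \<bar>strike_var a K T (T - t) - strike_var a K T (T - u)\<bar> / sqrt ?c"
    by (rule abs_sqrt_diff_le) (use c ge tu in auto)
  also have "\<dots> \<le> a_hi * \<bar>t - u\<bar> / sqrt ?c"
    using abs_strike_var_diff_le[of "T - u" "T - t"] mem c
    by (intro divide_right_mono) (auto simp: abs_minus_commute)
  finally have "S * \<bar>vol t - vol u\<bar> \<le> q * (a_hi * \<bar>t - u\<bar> / sqrt ?c)"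
    using assms by (intro mult_mono) auto
  moreover have "\<bar>bs_call S (disc t) (vol t) - bs_call S (disc u) (vol u)\<bar>
      \<le> \<bar>S - S\<bar> + \<bar>disc t - disc u\<bar> + S * \<bar>vol t - vol u\<bar>"
    by (rule bs_call_diff_le) (use assms K_pos mem vol_nonneg in auto)
  moreover note disc_diff_le[OF mem]
  ultimately show "dist (C_ref a K T r S t) (C_ref a K T r S u)
      \<le> (\<bar>r\<bar> * (K * exp (\<bar>r\<bar> * T)) + q * (a_hi / sqrt ?c)) * dist t u"
    using assms mem by (simp add: C_ref_eq dist_real_def algebra_simps)
qed

lemma C_ref_spot_derivatives:
  assumes "0 < S" "t \<in> {0..<T}"
  shows "((\<lambda>s. C_ref a K T r s t) has_real_derivative std_normal_cdf (dplus S t)) (at S)"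
    and "((\<lambda>s. std_normal_cdf (dplus s t)) has_real_derivative
      std_normal_density (dplus S t) / (S * vol t)) (at S)"
proof -
  note D = bs_call_spot_derivatives[OF assms(1) _ vol_pos[OF assms(2)], of "disc t"]
  show "((\<lambda>s. C_ref a K T r s t) has_real_derivative std_normal_cdf (dplus S t)) (at S)"
    by (rule has_field_derivative_transform_within_open[OF D(1), of "{0<..}"])
      (use assms K_pos in \<open>auto simp: C_ref_eq\<close>)
  show "((\<lambda>s. std_normal_cdf (dplus s t)) has_real_derivative
      std_normal_density (dplus S t) / (S * vol t)) (at S)"
    by (rule D(2)) (use K_pos in auto)
qed

text \<open>The source is defined by an iterated \<open>deriv\<close>, so the first derivative must
  be identified on the whole open half-line before it is differentiated again.\<close>

lemma correction_source_eq:
  assumes "0 < S" "t \<in> {0..<T}"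
  shows "correction_source a K T r S t
    = 1 / 2 * (a S t - a K t) * S\<^sup>2 * (std_normal_density (dplus S t) / (S * vol t))"
proof -
  have "(deriv (\<lambda>s. C_ref a K T r s t) has_real_derivative
      std_normal_density (dplus S t) / (S * vol t)) (at S)"
    by (rule has_field_derivative_transform_within_open[OF C_ref_spot_derivatives(2)[OF assms],
          of "{0<..}"])
      (use assms DERIV_imp_deriv[OF C_ref_spot_derivatives(1)] in auto)
  then show ?thesis
    unfolding correction_source_def by (simp add: numeral_2_eq_2 DERIV_imp_deriv)
qed

text \<open>Outside \<open>Z\<close> the integrated variance is differentiable, and it enters only
  through \<open>vol\<close>; the spot is constant in time and the discounted strike grows at rate
  \<open>r\<close>.\<close>

lemma C_ref_time_derivative:
  assumes "0 < S" "t \<in> {0..<T}" "t \<notin> Z"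
  shows "(C_ref a K T r S has_real_derivative
      - (r * disc t) * std_normal_cdf (ln (S / disc t) / vol t - vol t / 2)
      - S * std_normal_density (dplus S t) * (a K t / (2 * vol t))) (at t within {0..T})"
proof -
  have "(strike_var a K T has_real_derivative a K t) (at (T - t) within {0..T})"
    using exceptional assms unfolding exceptional_times_def
    by (auto dest!: bspec[where x = "T - t"])
  \<comment> \<open>Time reversal maps the interval onto itself, so the one-sided derivative at
    \<open>t = 0\<close> corresponds to the one at \<open>\<tau> = T\<close>.\<close>
  moreover have "(\<lambda>t. T - t) ` {0..T} = {0..T}"
    by (auto simp: image_iff intro!: bexI[of _ "T - _"])
  ultimately have "(strike_var a K T \<circ> (\<lambda>t. T - t) has_real_derivative a K t * (- 1))
      (at t within {0..T})"
    by (intro DERIV_image_chain) (auto intro!: derivative_eq_intros)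
  then have A: "((\<lambda>t. strike_var a K T (T - t)) has_real_derivative - a K t) (at t within {0..T})"
    by (simp add: o_def)
  have "0 < strike_var a K T (T - t)"
    using vol_pos[OF assms(2)] by simp
  from DERIV_chain2[OF DERIV_real_sqrt[OF this] A]
  have v: "(vol has_real_derivative - (a K t / (2 * vol t))) (at t within {0..T})"
    by (simp add: field_simps)
  have "((\<lambda>t. bs_call S (disc t) (vol t)) has_real_derivative
      0 * std_normal_cdf (dplus S t)
      - (r * disc t) * std_normal_cdf (ln (S / disc t) / vol t - vol t / 2)
      + S * std_normal_density (dplus S t) * - (a K t / (2 * vol t))) (at t within {0..T})"
    by (rule bs_call_has_real_derivative[OF _ _ disc_has_real_derivative _ v])
      (use assms K_pos vol_pos in auto)
  then have "((\<lambda>t. bs_call S (disc t) (vol t)) has_real_derivative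
      - (r * disc t) * std_normal_cdf (ln (S / disc t) / vol t - vol t / 2)
      - S * std_normal_density (dplus S t) * (a K t / (2 * vol t))) (at t within {0..T})"
    by simp
  then show ?thesis
    by (rule has_field_derivative_transform_within[where d = 1]) (use assms in \<open>auto simp: C_ref_eq\<close>)
qed

text \<open>The time derivative contains the second-order term with \<open>a K t\<close> in place of
  \<open>a S t\<close>. The terms with \<open>r\<close> cancel by the pricing formula, and what
  remains is half the variance difference times \<open>S\<^sup>2 C\<^sub>S\<^sub>S\<close>, that is,
  the correction source. The carrier therefore has its negative as source.\<close>

lemma classical_solution_C_ref:
  "classical_solution Z a r T (\<lambda>S t. - correction_source a K T r S t) (call_payoff K) (C_ref a K T r)"
  unfolding classical_solution_def
proof (intro conjI allI impI)
  show "continuous_on ({0<..} \<times> {0..T}) (\<lambda>(S, t). C_ref a K T r S t)"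
    by (rule continuous_on_C_ref)
  show "C_ref a K T r S T = call_payoff K S" for S
    by (simp add: C_ref_def call_payoff_def)
  show "\<exists>L. \<forall>S\<in>{p..q}. L-lipschitz_on {0..s} (C_ref a K T r S)" if "0 < p" "s < T" for p q s
    using C_ref_lipschitz_time[OF that(2)] that(1)
    by (intro exI[of _ "\<bar>r\<bar> * (K * exp (\<bar>r\<bar> * T)) + q * (a_hi / sqrt (a_lo * (T - s)))"]) auto
  have var: "continuous_on ({0<..} \<times> {0..<T}) (\<lambda>z :: real \<times> real. strike_var a K T (T - snd z))"
    by (intro continuous_on_strike_var continuous_on_snd) auto
  have var_nz: "strike_var a K T (T - t) \<noteq> 0" if "0 \<le> t" "t < T" for t
    using strike_var_pos[of "T - t"] that by simp
  have dplus: "continuous_on ({0<..} \<times> {0..<T}) (\<lambda>z. dplus (fst z) (snd z))"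
    by (intro continuous_intros var) (use K_pos var_nz in auto)
  show "\<exists>uS uSS. continuous_on ({0<..} \<times> {0..<T}) (\<lambda>(S, t). uS S t) \<and>
      continuous_on ({0<..} \<times> {0..<T}) (\<lambda>(S, t). uSS S t) \<and>
      (\<forall>S>0. \<forall>t\<in>{0..<T}.
        ((\<lambda>s. C_ref a K T r s t) has_real_derivative uS S t) (at S) \<and>
        ((\<lambda>s. uS s t) has_real_derivative uSS S t) (at S) \<and>
        (t \<notin> Z \<longrightarrow>
          (\<exists>ut. (C_ref a K T r S has_real_derivative ut) (at t within {0..T}) \<and>
            ut + 1 / 2 * a S t * S\<^sup>2 * uSS S t + r * S * uS S t - r * C_ref a K T r S t
              + - correction_source a K T r S t = 0)))"
  proof (rule exI[of _ "\<lambda>S t. std_normal_cdf (dplus S t)"],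
      rule exI[of _ "\<lambda>S t. std_normal_density (dplus S t) / (S * vol t)"], intro conjI allI ballI impI)
    show "continuous_on ({0<..} \<times> {0..<T}) (\<lambda>(S, t). std_normal_cdf (dplus S t))"
      unfolding case_prod_beta by (intro continuous_intros dplus)
    show "continuous_on ({0<..} \<times> {0..<T}) (\<lambda>(S, t). std_normal_density (dplus S t) / (S * vol t))"
      unfolding case_prod_beta
      by (intro continuous_intros dplus var) (use var_nz in auto)
  next
    fix S t :: real assume St: "0 < S" "t \<in> {0..<T}"
    show "((\<lambda>s. C_ref a K T r s t) has_real_derivative std_normal_cdf (dplus S t)) (at S)"
      "((\<lambda>s. std_normal_cdf (dplus s t)) has_real_derivative
        std_normal_density (dplus S t) / (S * vol t)) (at S)"
      by (rule C_ref_spot_derivatives[OF St])+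
    assume "t \<notin> Z"
    show "\<exists>ut. (C_ref a K T r S has_real_derivative ut) (at t within {0..T}) \<and>
      ut + 1 / 2 * a S t * S\<^sup>2 * (std_normal_density (dplus S t) / (S * vol t))
        + r * S * std_normal_cdf (dplus S t) - r * C_ref a K T r S t
        + - correction_source a K T r S t = 0"
    proof (intro exI conjI, rule C_ref_time_derivative[OF St \<open>t \<notin> Z\<close>])
      define k v p q f where "k = disc t" and "v = vol t" and "p = std_normal_cdf (dplus S t)"
        and "q = std_normal_cdf (ln (S / disc t) / vol t - vol t / 2)"
        and "f = std_normal_density (dplus S t)"
      have v: "0 < v" unfolding v_def by (rule vol_pos[OF St(2)])
      have C: "C_ref a K T r S t = S * p - k * q"
        using St vol_pos[OF St(2)] by (subst C_ref_eq) (auto simp: bs_call_def p_def q_def k_def)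
      have "- (r * k) * q - S * f * (a K t / (2 * v)) + 1 / 2 * a S t * S\<^sup>2 * (f / (S * v))
        + r * S * p - r * (S * p - k * q)
        + - (1 / 2 * (a S t - a K t) * S\<^sup>2 * (f / (S * v))) = 0"
        using v St by (simp add: field_simps power2_eq_square)
      then show "- (r * disc t) * std_normal_cdf (ln (S / disc t) / vol t - vol t / 2)
        - S * std_normal_density (dplus S t) * (a K t / (2 * vol t))
        + 1 / 2 * a S t * S\<^sup>2 * (std_normal_density (dplus S t) / (S * vol t))
        + r * S * std_normal_cdf (dplus S t) - r * C_ref a K T r S t
        + - correction_source a K T r S t = 0"
        unfolding correction_source_eq[OF St] C
        unfolding k_def v_def p_def q_def f_def .
    qed
  qed
qed

lemma exp_growth_C_ref: "exp_growth K T (C_ref a K T r)"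
  unfolding exp_growth_def
proof (intro exI allI ballI)
  fix x \<tau> :: real assume \<tau>: "\<tau> \<in> {0..T}"
  then have t: "T - \<tau> \<in> {0..T}" by auto
  have "\<bar>C_ref a K T r (K * exp x) (T - \<tau>)\<bar> \<le> K * exp x + disc (T - \<tau>)"
    using K_pos t by (subst C_ref_eq) (auto intro!: abs_bs_call_le)
  also have "\<dots> \<le> K * exp \<bar>x\<bar> + K * exp (\<bar>r\<bar> * T) * exp \<bar>x\<bar>"
  proof (rule add_mono)
    have "K * exp (\<bar>r\<bar> * T) * 1 \<le> K * exp (\<bar>r\<bar> * T) * exp \<bar>x\<bar>"
      using K_pos by (intro mult_left_mono) auto
    with disc_le[OF t] show "disc (T - \<tau>) \<le> K * exp (\<bar>r\<bar> * T) * exp \<bar>x\<bar>"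
      by linarith
  qed (use K_pos in auto)
  finally show "\<bar>C_ref a K T r (K * exp x) (T - \<tau>)\<bar> \<le> (K + K * exp (\<bar>r\<bar> * T)) * exp (1 * \<bar>x\<bar>)"
    by (simp add: distrib_right)
qed

section \<open>The uniform bound on the correction source\<close>

text \<open>Here \<open>b\<close> dominates the volatility, and \<open>e\<close> dominates the part
  of \<open>\<bar>x\<bar> / vol t\<close> that does not come from \<open>dplus\<close>. Given the
  common constants, the contract enters the bound only through the factor \<open>K\<close>, which
  the normalisation of the theorem divides out.\<close>

lemma abs_correction_source_le:
  fixes B :: real
  defines "b \<equiv> sqrt (a_hi * B)"
  defines "e \<equiv> b * (B / a_lo + 1 / 2)"
  assumes St: "0 < S" "t \<in> {0..<T}" and B: "T \<le> B" "\<bar>r\<bar> \<le> B"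
  shows "\<bar>correction_source a K T r S t\<bar>
    \<le> K * (L / 2 * exp (B * B) * ((1 + e) * exp ((b + 1)\<^sup>2 / 2)))"
proof -
  define x \<tau> v d where "x = ln (S / K)" and "\<tau> = T - t" and "v = vol t" and "d = dplus S t"
  have \<tau>: "0 < \<tau>" "\<tau> \<le> T" "\<tau> \<in> {0..T}" "T - \<tau> = t"
    using St by (auto simp: \<tau>_def)
  have S: "S = K * exp x" using St K_pos by (simp add: x_def)
  have v: "0 < v" unfolding v_def by (rule vol_pos[OF St(2)])
  have v2: "v\<^sup>2 = strike_var a K T \<tau>"
    using strike_var_pos[OF \<tau>(1,2)] by (simp add: v_def \<tau>_def)
  have "strike_var a K T \<tau> \<le> a_hi * B"
    using strike_var_bounds(2)[of \<tau>] \<tau> B a_hi_pos mult_left_mono[of \<tau> B a_hi] by linarith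
  then have vb: "v \<le> b" by (simp add: v_def b_def \<tau>_def)
  have L: "0 \<le> L" using lipschitz[OF \<tau>(3)] by (rule lipschitz_on_nonneg)
  have b0: "0 \<le> b" and B0: "0 \<le> B" using v vb B by auto
  have e: "0 \<le> e" unfolding e_def using b0 B0 a_lo_pos by (intro mult_nonneg_nonneg) auto
  \<comment> \<open>The definition of \<open>dplus\<close> is solved for the log-moneyness.\<close>
  have x: "x = v * d - r * \<tau> - v\<^sup>2 / 2"
  proof -
    have "ln (S / disc t) = x + r * \<tau>"
      using St K_pos by (simp add: x_def \<tau>_def ln_div ln_mult)
    then have "d = (x + r * \<tau>) / v + v / 2" by (simp add: d_def v_def)
    then show ?thesis using v by (simp add: field_simps power2_eq_square)
  qed
  have r\<tau>: "\<bar>r * \<tau>\<bar> \<le> B * \<tau>" using B \<tau> by (simp add: abs_mult)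
  \<comment> \<open>The lower variance bound turns the drift \<open>r * \<tau>\<close> into a
    multiple of \<open>v\<^sup>2\<close>. Every term then has a factor \<open>v\<close>, which
    cancels the singular \<open>1 / v\<close> in the second derivative.\<close>
  have "\<bar>x\<bar> \<le> v * (\<bar>d\<bar> + e)"
  proof -
    have "\<bar>v * d\<bar> = v * \<bar>d\<bar>" using v by (simp add: abs_mult)
    moreover have "\<tau> \<le> v\<^sup>2 / a_lo"
      using strike_var_bounds(1)[of \<tau>] \<tau> a_lo_pos by (simp add: v2 field_simps)
    then have "B * \<tau> \<le> B * (v\<^sup>2 / a_lo)" using B0 by (rule mult_left_mono)
    ultimately have "\<bar>x\<bar> \<le> v * \<bar>d\<bar> + B * (v\<^sup>2 / a_lo) + v\<^sup>2 / 2"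
      unfolding x using r\<tau> zero_le_power2[of v] by linarith
    also have "\<dots> = v * (\<bar>d\<bar> + v * (B / a_lo + 1 / 2))"
      by (simp add: algebra_simps power2_eq_square)
    also have "\<dots> \<le> v * (\<bar>d\<bar> + e)"
      unfolding e_def using v vb B0 a_lo_pos
      by (intro mult_left_mono add_mono mult_right_mono) auto
    finally show ?thesis .
  qed
  then have xv: "\<bar>x\<bar> / v \<le> \<bar>d\<bar> + e" using v by (simp add: field_simps)
  \<comment> \<open>The negative term \<open>- v\<^sup>2 / 2\<close> of \<open>x\<close> is dropped.
    The unbounded factor that remains depends on \<open>\<bar>d\<bar>\<close> alone and is left to
    the Gaussian.\<close>
  have Sle: "S \<le> K * exp (B * B) * exp (b * \<bar>d\<bar>)"
  proof -
    have "v * d \<le> b * \<bar>d\<bar>"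
      using vb v abs_ge_self[of d]
      by (meson abs_ge_zero less_imp_le mult_left_mono mult_right_mono order_trans)
    moreover have "B * \<tau> \<le> B * B" using \<tau> B B0 by (intro mult_left_mono) auto
    ultimately have "x \<le> B * B + b * \<bar>d\<bar>"
      unfolding x using r\<tau> zero_le_power2[of v] by linarith
    then show ?thesis using K_pos by (simp add: S exp_add[symmetric] mult.assoc)
  qed
  have "\<bar>a S t - a K t\<bar> \<le> L * \<bar>x\<bar>"
    using lipschitz_onD[OF lipschitz[OF \<tau>(3)], of x 0] \<tau>(4)
    by (simp add: log_var_def S dist_real_def)
  then have le: "\<bar>a S t - a K t\<bar> * (S * std_normal_density d / v)
      \<le> L * \<bar>x\<bar> * (S * std_normal_density d / v)"
    using St v by (intro mult_right_mono) auto
  have "correction_source a K T r S t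
      = 1 / 2 * (a S t - a K t) * S\<^sup>2 * (std_normal_density d / (S * v))"
    unfolding d_def v_def by (rule correction_source_eq[OF St])
  then have "\<bar>correction_source a K T r S t\<bar>
      = 1 / 2 * (\<bar>a S t - a K t\<bar> * (S * std_normal_density d / v))"
    using St v by (simp add: abs_mult power2_eq_square)
  also have "\<dots> \<le> 1 / 2 * (L * \<bar>x\<bar> * (S * std_normal_density d / v))"
    by (rule mult_left_mono[OF le]) simp
  also have "\<dots> = L / 2 * (S * std_normal_density d * (\<bar>x\<bar> / v))"
    by simp
  also have "\<dots> \<le> L / 2 * (K * exp (B * B) * exp (b * \<bar>d\<bar>) * std_normal_density d * (\<bar>d\<bar> + e))"
    using L K_pos St v e by (intro mult_left_mono mult_mono Sle xv) auto
  also have "\<dots> = K * (L / 2 * exp (B * B) * (exp (b * \<bar>d\<bar>) * std_normal_density d * (\<bar>d\<bar> + e)))"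
    by (simp only: mult_ac)
  also have "\<dots> \<le> K * (L / 2 * exp (B * B) * ((1 + e) * exp ((b + 1)\<^sup>2 / 2)))"
    using K_pos L by (intro mult_left_mono gaussian_absorbs e) auto
  finally show ?thesis .
qed

end

section \<open>Uniformity over the class of contracts\<close>

theorem proposition3p1:
  fixes contracts :: "(real \<times> real \<times> real) set"
    and \<sigma> :: "real \<Rightarrow> real \<Rightarrow> real" and D :: "(real \<times> real) set"
    and a V :: "real \<Rightarrow> real \<Rightarrow> real \<Rightarrow> real \<Rightarrow> real \<Rightarrow> real"
    and Z :: "real \<Rightarrow> real \<Rightarrow> real \<Rightarrow> real set"
    and sol :: solution_concept
    and \<epsilon> a_lo a_hi L :: real
  assumes compact_class: "compact contracts"
    and away_from_zero: "\<epsilon> > 0"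
      "\<And>K T r. (K, T, r) \<in> contracts \<Longrightarrow> \<epsilon> \<le> K \<and> \<epsilon> \<le> T"
    and extension: "\<And>K T r x \<tau>. (K, T, r) \<in> contracts \<Longrightarrow> \<tau> \<in> {0..T} \<Longrightarrow>
      (K * exp x, T - \<tau>) \<in> D \<Longrightarrow>
      log_var (a K T r) K T x \<tau> = (\<sigma> (K * exp x) (T - \<tau>))\<^sup>2"
    and strike_integrable: "\<And>K T r. (K, T, r) \<in> contracts \<Longrightarrow>
      (\<lambda>u. a K T r K (T - u)) integrable_on {0..T}"
    and exceptional: "\<And>K T r. (K, T, r) \<in> contracts \<Longrightarrow>
      exceptional_times (a K T r) K T (Z K T r)"
    and bounds: "0 < a_lo"
      "\<And>K T r x \<tau>. (K, T, r) \<in> contracts \<Longrightarrow> \<tau> \<in> {0..T} \<Longrightarrow>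
        a_lo \<le> log_var (a K T r) K T x \<tau> \<and> log_var (a K T r) K T x \<tau> \<le> a_hi"
    and lipschitz: "\<And>K T r \<tau>. (K, T, r) \<in> contracts \<Longrightarrow> \<tau> \<in> {0..T} \<Longrightarrow>
      L-lipschitz_on UNIV (\<lambda>x. log_var (a K T r) K T x \<tau>)"
    and solution_notion: "\<And>K T r. (K, T, r) \<in> contracts \<Longrightarrow>
      consistent sol (Z K T r) (a K T r) K T r"
    and pricing_unique: "\<And>K T r. (K, T, r) \<in> contracts \<Longrightarrow>
      unique_solvability sol (a K T r) K T r (\<lambda>S t. 0) (call_payoff K)"
    and correction_unique: "\<And>K T r. (K, T, r) \<in> contracts \<Longrightarrow>
      unique_solvability sol (a K T r) K T r (correction_source (a K T r) K T r) (\<lambda>S. 0)"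
    and comparison: "\<And>K T r. (K, T, r) \<in> contracts \<Longrightarrow>
      comparison_principle sol (a K T r) K T r"
    and call_price: "\<And>K T r. (K, T, r) \<in> contracts \<Longrightarrow>
      exp_growth K T (V K T r) \<and> sol (a K T r) r T (\<lambda>S t. 0) (call_payoff K) (V K T r)"
  shows "\<exists>C. \<forall>(K, T, r) \<in> contracts. \<forall>\<tau> \<in> {0<..T}.
    (SUP x. ereal (\<bar>V K T r (K * exp x) (T - \<tau>) - C_ref (a K T r) K T r (K * exp x) (T - \<tau>)\<bar> / K))
      \<le> ereal (C * \<tau>)"
proof -
  \<comment> \<open>Compactness enters through this \<open>B\<close>, which bounds every
    \<open>T\<close> and every \<open>\<bar>r\<bar>\<close> at once.\<close>
  obtain B where B: "\<And>z. z \<in> contracts \<Longrightarrow> norm z \<le> B"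
    using compact_imp_bounded[OF compact_class] by (auto simp: bounded_iff)
  define b where "b = sqrt (a_hi * B)"
  define e where "e = b * (B / a_lo + 1 / 2)"
  define M where "M = L / 2 * exp (B * B) * ((1 + e) * exp ((b + 1)\<^sup>2 / 2))"
  have main: "\<bar>V K T r (K * exp x) (T - \<tau>) - C_ref (a K T r) K T r (K * exp x) (T - \<tau>)\<bar> / K
      \<le> M * exp (B * B) * \<tau>"
    if c: "(K, T, r) \<in> contracts" and \<tau>: "\<tau> \<in> {0<..T}" for K T r \<tau> x
  proof -
    let ?C = "C_ref (a K T r) K T r" and ?F = "correction_source (a K T r) K T r"
    have pos: "0 < K" "0 < T"
      using away_from_zero(1) away_from_zero(2)[OF c] by auto
    have le_B: "T \<le> B" "\<bar>r\<bar> \<le> B"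
      using norm_snd_le[of "(T, r)" K] norm_fst_le[of T r] norm_snd_le[of r T] B[OF c]
      by auto
    interpret bounded_variance "a K T r" K T r a_lo a_hi L "Z K T r"
      by unfold_locales
        (use pos bounds strike_integrable exceptional lipschitz c in auto)
    have src: "\<bar>?F S t\<bar> \<le> K * M" if "0 < S" "t \<in> {0..<T}" for S t
      unfolding M_def e_def b_def by (rule abs_correction_source_le) (use that le_B in auto)
    \<comment> \<open>\<open>K * M\<close> bounds an absolute value, here that of the source at spot
      1 and time 0; this gives its sign.\<close>
    have "0 \<le> K * M" using src[of 1 0] pos by fastforce
    moreover from this have "0 \<le> M" using pos by (simp add: zero_le_mult_iff)
    ultimately have N: "0 \<le> K * M" "0 \<le> M" by auto
    have growth: "exp_growth K T (\<lambda>S t. V K T r S t - ?C S t)"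
      using exp_growth_diff call_price[OF c] exp_growth_C_ref by blast
    \<comment> \<open>Consistency permits subtracting the classical solution \<open>?C\<close>,
      whose source is \<open>- ?F\<close>: the source becomes \<open>?F\<close> and the payoffs
      cancel.\<close>
    have "sol (a K T r) r T (\<lambda>S t. 0 - - ?F S t) (\<lambda>S. call_payoff K S - call_payoff K S)
        (\<lambda>S t. V K T r S t - ?C S t)"
      using solution_notion[OF c] call_price[OF c] classical_solution_C_ref exp_growth_C_ref
      unfolding consistent_def by blast
    then have W: "sol (a K T r) r T ?F (\<lambda>S. 0) (\<lambda>S t. V K T r S t - ?C S t)"
      by simp
    have "\<bar>V K T r (K * exp x) (T - \<tau>) - ?C (K * exp x) (T - \<tau>)\<bar>
        \<le> K * M * (T - (T - \<tau>)) * exp (\<bar>r\<bar> * (T - (T - \<tau>)))"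
    proof (rule abs_solution_le[where sol = sol and Z = "Z K T r" and a = "a K T r" and F = ?F
          and w = "\<lambda>S t. V K T r S t - ?C S t" and K = K and N = "K * M"])
      show "consistent sol (Z K T r) (a K T r) K T r" "comparison_principle sol (a K T r) K T r"
        by (rule solution_notion[OF c], rule comparison[OF c])
    qed (use growth W src N pos \<tau> in auto)
    also have "\<dots> \<le> K * M * \<tau> * exp (B * B)"
      using N \<tau> le_B pos by (intro mult_mono) (auto intro!: mult_mono)
    finally show ?thesis using pos by (simp add: field_simps)
  qed
  show ?thesis
    \<comment> \<open>The factor \<open>exp (B * B)\<close> bounds the growth
      \<open>exp (\<bar>r\<bar> * \<tau>)\<close> of the barrier. The supremum is taken in
      \<open>ereal\<close>, so pointwise bounds suffice.\<close>
    by (rule exI[of _ "M * exp (B * B)"]) (auto intro!: SUP_least main)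
qed

end
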